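(* For every $n\ge1$, the reverse bumping algorithm (which takes a pair $(T,R)$ of standard Young bitableaux of the same shape, a bipartition of $n$, and outputs a signed permutation $\mathrm{eRS}(T,R)\in W(C_n)$) and the insertion algorithm (which takes $w\in W(C_n)$ and outputs a pair of standard Young bitableaux of the same shape) are mutually inverse. In particular they give mutually inverse bijections between $W(C_n)$ and $\bigsqcup_{(\mu,\nu)}\mathcal{T}(\mu,\nu)\times\mathcal{T}(\mu,\nu)$, where $(\mu,\nu)$ runs over all bipartitions of $n$ and $\mathcal{T}(\mu,\nu)$ is the set of standard Young bitableaux of shape $(\mu,\nu)$.
   Context: $W(C_n)$ is the set of signed permutations $w=w_1\cdots w_n$ (also written $w_k=w(k)$), with $w_i\in\{1,\dots,n,\bar1,\dots,\bar n\}$ and the absolute values forming a permutation of $\{1,\dots,n\}$. A bipartition of $n$ is a pair of partitions $(\mu,\nu)$ with $|\mu|+|\nu|=n$. A standard Young bitableau of shape $(\mu,\nu)$ is a filling of the two Young diagrams by $1,\dots,n$, each used once, with numbers increasing down columns and along rows moving away from the vertical wall between the diagrams (the left diagram, of shape $\mu$, has rows reversed, so they increase from right to left; the right diagram, of shape $\nu$, is to the right of the wall). Rows are numbered $\mu_1=1,\ \nu_1=2,\ \mu_2=3,\ \nu_2=4,\ \mu_3=5,\dots$ Intermediate bitableaux below have distinct entries satisfying the same increasing conditions. For a bitableau $T$ not containing $s$: - an available position for $s$ is a box of $T$ whose entry is smaller than $s$ and such that replacing this entry by $s$ keeps the increasing conditions (there is at most one per row); - an insertable position for $s$ is either a position outside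 $T$ and adjacent to a box of $T$ (for empty $T$: the first position in row 1 or in row 2), or a box of $T$ whose entry is larger than $s$, such that after putting $s$ there (replacing the entry if there is one) the shape is still a bipartition and the increasing conditions hold. Reverse bumping algorithm. Input: standard bitableaux $T,R$ of the same shape with $n$ boxes. (1) Start with $k=n$. (2) Find the box of $R$ containing $k$. Let $s$ be the entry of $T$ in the same box and $m$ the number of its row. Let $R'$ be $R$ with $k$ removed and $T'$ be $T$ with $s$ removed. (3) If $m=1$, set $w(k)=s$. If $k=1$ stop; otherwise return to (2) with $k$ replaced by $k-1$ and $(T,R)$ replaced by $(T',R')$. (4) If $m\ne1$, consider all available positions for $s$ in $T'$ in rows numbered $\ge m-1$. (5) If there are none, set $w(k)=\bar s$; if $k=1$ stop, otherwise return to (2) with $k$ replaced by $k-1$ and $(T,R)$ replaced by $(T',R')$. (6) Otherwise take the one in the smallest-numbered row, replace its entry $s'$ by $s$ (the result is the new $T'$), let $m$ be the number of that row, and return to (3) with $s$ replaced by $s'$. The output is $\mathrm{eRS}(T,R)=w(1)\cdots w(n)$. Insertion algorithm. Input: $w=w_1\cdots w_n\in W(C_n)$. (1) Let $T,R$ be empty bitableaux and $k=1$. (2) If $w_k=s\in\{1,\dots,n\}$, put $s$ in the insertable position in row 1 of $T$ (it always exists). (3) If $w_k=\bar s$, put $s$ in the insertable position either in the first column to the left of the wall or in the first column to the right of the wall of $T$, whichever has the higher row number (such positions always exist). (4) Let $m$ be the number of the row where $s$ was inserted. (5) If $s$ was put in an empty position, add a box with $k$ in the same position to $R$. If $k=n$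 stop; otherwise go back to (2)/(3) with $k$ replaced by $k+1$. (6) Otherwise, if $s$ replaced a number $s'$, consider the insertable positions for $s'$ in $T$ in rows numbered $\le m+1$ (there is always at least one). Put $s'$ in the one with the highest row number, replace $s$ by $s'$, and return to (4). The output is $(T,R)$. *)

theory Defs
  imports Main "HOL-Library.Monad_Syntax" "HOL-Library.Disjoint_Sets"
begin

text \<open>A signed permutation \<open>w\<close> is the word \<open>w(1) \<dots> w(n)\<close> of its values, a barred value being a
  negative integer; \<open>w(k)\<close> is \<open>w ! (k - 1)\<close>.\<close>

definition signed_permutations :: "nat \<Rightarrow> int list set" where
  "signed_permutations n =
     {w. length w = n \<and> distinct (map abs w) \<and> set (map abs w) = {1..int n}}"

definition is_partition :: "nat list \<Rightarrow> bool" where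
  "is_partition \<mu> \<longleftrightarrow> sorted_wrt (\<ge>) \<mu> \<and> 0 \<notin> set \<mu>"

definition bipartitions :: "nat \<Rightarrow> (nat list \<times> nat list) set" where
  "bipartitions n =
     {(\<mu>, \<nu>). is_partition \<mu> \<and> is_partition \<nu> \<and> sum_list \<mu> + sum_list \<nu> = n}"

text \<open>A position is a pair (row number, distance from the wall), both counted from 1. The odd rows
  \<open>2 * i - 1\<close> are the rows \<open>\<mu>\<^sub>i\<close> to the left of the wall, the even rows \<open>2 * i\<close> are the rows \<open>\<nu>\<^sub>i\<close>
  to its right. So \<open>(r, c + 1)\<close> is the neighbour of \<open>(r, c)\<close> away from the wall, and \<open>(r + 2, c)\<close>
  is the neighbour below it.\<close>

type_synonym box = "nat \<times> nat"

definition diagram :: "nat list \<Rightarrow> nat list \<Rightarrow> box set" where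
  "diagram \<mu> \<nu> =
     {(2 * i + 1, j + 1) | i j. i < length \<mu> \<and> j < \<mu> ! i} \<union>
     {(2 * i + 2, j + 1) | i j. i < length \<nu> \<and> j < \<nu> ! i}"

definition bipartition_shape :: "box set \<Rightarrow> bool" where
  "bipartition_shape D \<longleftrightarrow> (\<exists>\<mu> \<nu>. is_partition \<mu> \<and> is_partition \<nu> \<and> D = diagram \<mu> \<nu>)"

text \<open>A filling is a partial map; its domain is its set of boxes.\<close>

type_synonym bitableau = "box \<rightharpoonup> nat"

definition increasing :: "bitableau \<Rightarrow> bool" where
  "increasing T \<longleftrightarrow>
     (\<forall>r c c' x y. T (r, c) = Some x \<and> T (r, c') = Some y \<and> c < c' \<longrightarrow> x < y) \<and>
     (\<forall>r r' c x y. T (r, c) = Some x \<and> T (r', c) = Some y \<and> r < r' \<and> even r = even r' \<longrightarrow> x < y)"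

definition standard_bitableaux :: "nat list \<Rightarrow> nat list \<Rightarrow> bitableau set" where
  "standard_bitableaux \<mu> \<nu> =
     {T. dom T = diagram \<mu> \<nu> \<and> increasing T \<and>
         bij_betw (the \<circ> T) (diagram \<mu> \<nu>) {1..sum_list \<mu> + sum_list \<nu>}}"

text \<open>The lemma \<open>disjoint_bitableau_pairs\<close> below shows that this union is disjoint.\<close>

definition bitableau_pairs :: "nat \<Rightarrow> (bitableau \<times> bitableau) set" where
  "bitableau_pairs n =
     (\<Union>(\<mu>, \<nu>)\<in>bipartitions n. standard_bitableaux \<mu> \<nu> \<times> standard_bitableaux \<mu> \<nu>)"

lemma partition_eqI:
  assumes "is_partition \<mu>" "is_partition \<mu>'"
    and eq: "\<And>i j. i < length \<mu> \<and> j < \<mu> ! i \<longleftrightarrow> i < length \<mu>' \<and> j < \<mu>' ! i"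
  shows "\<mu> = \<mu>'"
proof -
  have pos: "i < length \<mu> \<Longrightarrow> 0 < \<mu> ! i" "i < length \<mu>' \<Longrightarrow> 0 < \<mu>' ! i" for i
    using assms(1,2) by (auto simp: is_partition_def in_set_conv_nth intro!: gr0I)
  have "i < length \<mu> \<longleftrightarrow> i < length \<mu>'" for i
    using pos eq[of i 0] by blast
  then have len: "length \<mu> = length \<mu>'"
    by (meson linorder_neqE_nat nat_less_le order.refl)
  show ?thesis
  proof (rule nth_equalityI[OF len])
    fix i assume i: "i < length \<mu>"
    then have "j < \<mu> ! i \<longleftrightarrow> j < \<mu>' ! i" for j
      using eq[of i j] len by simp
    then show "\<mu> ! i = \<mu>' ! i"
      by (meson linorder_neqE_nat nat_less_le order.refl)
  qed
qed

lemma diagram_inject: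
  assumes "is_partition \<mu>" "is_partition \<nu>" "is_partition \<mu>'" "is_partition \<nu>'"
    and eq: "diagram \<mu> \<nu> = diagram \<mu>' \<nu>'"
  shows "\<mu> = \<mu>' \<and> \<nu> = \<nu>'"
proof
  have odd_iff: "(2 * i + 1, j + 1) \<in> diagram a b \<longleftrightarrow> i < length a \<and> j < a ! i" for a b i j
    unfolding diagram_def by (auto; presburger)
  have even_iff: "(2 * i + 2, j + 1) \<in> diagram a b \<longleftrightarrow> i < length b \<and> j < b ! i" for a b i j
    unfolding diagram_def by (auto; presburger)
  show "\<mu> = \<mu>'"
    by (rule partition_eqI[OF assms(1,3)]) (metis odd_iff eq)
  show "\<nu> = \<nu>'"
    by (rule partition_eqI[OF assms(2,4)]) (metis even_iff eq)
qed

lemma disjoint_bitableau_pairs: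
  "disjoint_family_on
     (\<lambda>(\<mu>, \<nu>). standard_bitableaux \<mu> \<nu> \<times> standard_bitableaux \<mu> \<nu>) (bipartitions n)"
  unfolding disjoint_family_on_def bipartitions_def standard_bitableaux_def
  using diagram_inject by fastforce

definition available :: "bitableau \<Rightarrow> nat \<Rightarrow> box set" where
  "available T s = {p. \<exists>x. T p = Some x \<and> x < s \<and> increasing (T(p \<mapsto> s))}"

text \<open>The rows \<open>2 * i - 1\<close> and \<open>2 * i\<close> are drawn at the same height, so their first boxes are
  adjacent, across the wall.\<close>

inductive adjacent :: "box \<Rightarrow> box \<Rightarrow> bool" where
  same_row: "adjacent (r, c) (r, c + 1)"
| same_column: "adjacent (r, c) (r + 2, c)"
| across_wall: "odd r \<Longrightarrow> adjacent (r, 1) (r + 1, 1)"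
| symmetric: "adjacent p q \<Longrightarrow> adjacent q p"

definition insertable :: "bitableau \<Rightarrow> nat \<Rightarrow> box set" where
  "insertable T s =
     {p. (case T p of
            None \<Rightarrow> if T = Map.empty then p = (1, 1) \<or> p = (2, 1) else \<exists>q\<in>dom T. adjacent p q
          | Some x \<Rightarrow> s < x) \<and>
         bipartition_shape (dom (T(p \<mapsto> s))) \<and> increasing (T(p \<mapsto> s))}"

text \<open>Whenever an algorithm refers to ``the'' object with a property, existence and uniqueness are
  part of the claim that it succeeds: otherwise the result is \<^term>\<open>None\<close>.\<close>

definition the_unique :: "('a \<Rightarrow> bool) \<Rightarrow> 'a option" where
  "the_unique P = (if \<exists>!x. P x then Some (THE x. P x) else None)"

definition lowest_row :: "box set \<Rightarrow> box option" where
  "lowest_row P = the_unique (\<lambda>p. p \<in> P \<and> (\<forall>q\<in>P. fst p \<le> fst q))"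

definition highest_row :: "box set \<Rightarrow> box option" where
  "highest_row P = the_unique (\<lambda>p. p \<in> P \<and> (\<forall>q\<in>P. fst q \<le> fst p))"

text \<open>\<open>unbump T m s\<close> treats the entry \<open>s\<close>, just taken out of row \<open>m\<close>; it returns the resulting
  value \<open>w(k)\<close> and the bitableau that is left.\<close>

partial_function (option) unbump :: "bitableau \<Rightarrow> nat \<Rightarrow> nat \<Rightarrow> (int \<times> bitableau) option" where
  "unbump T m s =
     (if m = 1 then Some (int s, T)
      else let P = {p \<in> available T s. fst p \<ge> m - 1} in
        if P = {} then Some (- int s, T)
        else do {
          p \<leftarrow> lowest_row P;
          s' \<leftarrow> T p;
          unbump (T(p \<mapsto> s)) (fst p) s'
        })"

text \<open>The first argument is the current value of \<open>k\<close>; the result is the word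
  \<open>w(1) \<dots> w(k)\<close>.\<close>

fun reverse_loop :: "nat \<Rightarrow> bitableau \<Rightarrow> bitableau \<Rightarrow> int list option" where
  "reverse_loop 0 T R = Some []"
| "reverse_loop (Suc k) T R = do {
     p \<leftarrow> the_unique (\<lambda>p. R p = Some (Suc k));
     s \<leftarrow> T p;
     (wk, T') \<leftarrow> unbump (T(p := None)) (fst p) s;
     w \<leftarrow> reverse_loop k T' (R(p := None));
     Some (w @ [wk])
   }"

definition eRS :: "bitableau \<Rightarrow> bitableau \<Rightarrow> int list option" where
  "eRS T R = reverse_loop (card (dom R)) T R"

text \<open>\<open>bump T s p\<close> puts \<open>s\<close> in position \<open>p\<close> and continues with the replaced entry, if any; it
  returns the final bitableau and the position of its new box.\<close>

partial_function (option) bump :: "bitableau \<Rightarrow> nat \<Rightarrow> box \<Rightarrow> (bitableau \<times> box) option" where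
  "bump T s p =
     (case T p of
        None \<Rightarrow> Some (T(p \<mapsto> s), p)
      | Some s' \<Rightarrow> do {
          q \<leftarrow> highest_row {q \<in> insertable (T(p \<mapsto> s)) s'. fst q \<le> fst p + 1};
          bump (T(p \<mapsto> s)) s' q
        })"

definition first_position :: "bitableau \<Rightarrow> int \<Rightarrow> box option" where
  "first_position T x =
     (if x > 0 then the_unique (\<lambda>p. p \<in> insertable T (nat x) \<and> fst p = 1)
      else highest_row {p \<in> insertable T (nat (- x)). snd p = 1})"

fun insertion_loop ::
  "nat \<Rightarrow> int list \<Rightarrow> bitableau \<Rightarrow> bitableau \<Rightarrow> (bitableau \<times> bitableau) option" where
  "insertion_loop k [] T R = Some (T, R)"
| "insertion_loop k (x # w) T R = do {
     p \<leftarrow> first_position T x;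
     (T', q) \<leftarrow> bump T (nat \<bar>x\<bar>) p;
     insertion_loop (k + 1) w T' (R(q \<mapsto> k))
   }"

definition insertion :: "int list \<Rightarrow> (bitableau \<times> bitableau) option" where
  "insertion w = insertion_loop 1 w Map.empty Map.empty"

end

theory Submission
  imports Defs
begin

text \<open>
  Let \<open>L r\<close> be the number of entries smaller than \<open>s\<close> in row \<open>r\<close>. A value \<open>s\<close> has an insertable position
  in row \<open>r\<close> iff \<open>r \<le> 2\<close> or \<open>L r < L (r - 2)\<close>, i.e. iff a box can be added in row \<open>r\<close> to the
  bipartition formed by these entries; it has an available position in row \<open>r\<close> iff
  \<open>L (r + 2) < L r\<close>, i.e. iff a box can be removed there. So row \<open>r > 2\<close> is insertable iff row
  \<open>r - 2\<close> is available. This duality makes ``the highest insertable row \<open>\<le> m + 1\<close>'' and ``the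
  lowest available row \<open>\<ge> m' - 1\<close>'' inverse choices, so each bumping step undoes a reverse bumping
  step and conversely. The stopping rules match too: rows 1 and 2 are always insertable, so bumping
  never returns to row 1, and no row \<open>\<ge> m - 1\<close> is available iff all of them have \<open>L r = 0\<close>, which
  means that \<open>s\<close> sits in the first column of the lower of the two candidate rows.
\<close>

section \<open>Bipartition shapes as finite sets of boxes closed towards the wall and
  upwards\<close>

lemma bipartition_shapeD:
  assumes "bipartition_shape D" "(r, c) \<in> D"
  shows "1 \<le> r" "1 \<le> c" "1 < c \<Longrightarrow> (r, c - 1) \<in> D" "2 < r \<Longrightarrow> (r - 2, c) \<in> D"
proof -
  obtain \<mu> \<nu> where p: "is_partition \<mu>" "is_partition \<nu>" and D: "D = diagram \<mu> \<nu>"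
    using assms(1) by (auto simp: bipartition_shape_def)
  have mono: "\<mu>' ! Suc i \<le> \<mu>' ! i" if "is_partition \<mu>'" "Suc i < length \<mu>'" for \<mu>' i
    using that by (auto simp: is_partition_def sorted_wrt_iff_nth_less)
  have left: "(2 * i + 1, j + 1) \<in> D \<longleftrightarrow> i < length \<mu> \<and> j < \<mu> ! i" for i j
    unfolding D diagram_def by (auto; presburger)
  have right: "(2 * i + 2, j + 1) \<in> D \<longleftrightarrow> i < length \<nu> \<and> j < \<nu> ! i" for i j
    unfolding D diagram_def by (auto; presburger)
  consider i j where "r = 2 * i + 1" "c = j + 1" | i j where "r = 2 * i + 2" "c = j + 1"
    using assms(2) unfolding D diagram_def by auto
  then have "1 \<le> r \<and> 1 \<le> c \<and> (1 < c \<longrightarrow> (r, c - 1) \<in> D) \<and> (2 < r \<longrightarrow> (r - 2, c) \<in> D)"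
  proof cases
    case 1
    then have ij: "i < length \<mu>" "j < \<mu> ! i" using assms(2) left by auto
    have "(r, c - 1) \<in> D" if "1 < c"
      using left[of i "j - 1"] ij 1 that by simp
    moreover have "(r - 2, c) \<in> D" if "2 < r"
      using left[of "i - 1" j] ij 1 that mono[OF p(1), of "i - 1"] by (cases i) auto
    ultimately show ?thesis using 1 by simp
  next
    case 2
    then have ij: "i < length \<nu>" "j < \<nu> ! i" using assms(2) right by auto
    have "(r, c - 1) \<in> D" if "1 < c"
      using right[of i "j - 1"] ij 2 that by simp
    moreover have "(r - 2, c) \<in> D" if "2 < r"
      using right[of "i - 1" j] ij 2 that mono[OF p(2), of "i - 1"] by (cases i) auto
    ultimately show ?thesis using 2 by simp
  qed
  then show "1 \<le> r" "1 \<le> c" "1 < c \<Longrightarrow> (r, c - 1) \<in> D" "2 < r \<Longrightarrow> (r - 2, c) \<in> D"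
    by blast+
qed

lemma diagram_eq:
  "diagram \<mu> \<nu> = (\<lambda>(i, j). (2 * i + 1, j + 1)) ` (SIGMA i:{..<length \<mu>}. {..<\<mu> ! i}) \<union>
    (\<lambda>(i, j). (2 * i + 2, j + 1)) ` (SIGMA i:{..<length \<nu>}. {..<\<nu> ! i})"
  unfolding diagram_def by auto

lemma finite_bipartition_shape:
  assumes "bipartition_shape D"
  shows "finite D"
proof -
  obtain \<mu> \<nu> where D: "D = diagram \<mu> \<nu>"
    using assms by (auto simp: bipartition_shape_def)
  show ?thesis unfolding D diagram_eq by simp
qed

definition row_len :: "box set \<Rightarrow> nat \<Rightarrow> nat" where
  "row_len D r = card {c. (r, c) \<in> D}"

lemma row_len_iff_gen:
  assumes fin: "finite D"
    and row: "\<And>r c. (r, c) \<in> D \<Longrightarrow> 1 \<le> c \<and> (1 < c \<longrightarrow> (r, c - 1) \<in> D)"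
  shows "(r, c) \<in> D \<longleftrightarrow> 1 \<le> c \<and> c \<le> row_len D r"
proof -
  let ?C = "{c. (r, c) \<in> D}"
  have finC: "finite ?C"
  proof (rule finite_subset)
    show "?C \<subseteq> snd ` D" by (auto intro: image_eqI[where x = "(r, c)" for c])
  qed (use fin in simp)
  have "?C = {1..card ?C}"
  proof -
    have down: "(r, c) \<in> D \<Longrightarrow> 1 \<le> d \<Longrightarrow> d \<le> c \<Longrightarrow> (r, d) \<in> D" for c d
    proof (induction c)
      case (Suc c)
      then show ?case using row[of r "Suc c"] by (cases "d = Suc c") auto
    qed simp
    show ?thesis
    proof (cases "?C = {}")
      case False
      have "(r, Max ?C) \<in> D" using Max_in[OF finC False] by simp
      then have "?C = {1..Max ?C}"
        using down[of "Max ?C"] Max_ge[OF finC] row[of r]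
        by (intro set_eqI) (metis atLeastAtMost_iff mem_Collect_eq)
      then show ?thesis by (metis card_atLeastAtMost diff_Suc_1)
    qed simp
  qed
  from eqset_imp_iff[OF this, of c] show ?thesis by (simp add: row_len_def)
qed

text \<open>Closure towards the wall makes each row an initial segment, so \<open>D\<close> is known
  from its row lengths; closure upwards makes these lengths weakly decrease along the rows of one
  side. Finiteness makes them vanish eventually, and cutting off the zeros leaves a partition on
  each side.\<close>

lemma bipartition_shapeI:
  assumes fin: "finite D"
    and D: "\<And>r c. (r, c) \<in> D \<Longrightarrow>
      1 \<le> r \<and> 1 \<le> c \<and> (1 < c \<longrightarrow> (r, c - 1) \<in> D) \<and> (2 < r \<longrightarrow> (r - 2, c) \<in> D)"
  shows "bipartition_shape D"
proof -
  have row: "(r, c) \<in> D \<longleftrightarrow> 1 \<le> c \<and> c \<le> row_len D r" for r c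
    by (rule row_len_iff_gen[OF fin]) (use D in blast)
  \<comment> \<open>The offset \<open>a\<close> selects the side: 1 gives the rows to the left of
    the wall, 2 those to its right.\<close>
  have partition: "\<exists>\<mu>. is_partition \<mu> \<and> (\<forall>i j. i < length \<mu> \<and> j < \<mu> ! i \<longleftrightarrow> (2 * i + a, j + 1) \<in> D)"
    if a: "0 < a" for a
  proof -
    have step: "row_len D (2 * Suc i + a) \<le> row_len D (2 * i + a)" for i
      using D[of "2 * Suc i + a" "row_len D (2 * Suc i + a)"] a
      by (cases "row_len D (2 * Suc i + a) = 0") (auto simp: row)
    have anti: "i \<le> j \<Longrightarrow> row_len D (2 * j + a) \<le> row_len D (2 * i + a)" for i j
      by (rule lift_Suc_antimono_le[of "\<lambda>i. row_len D (2 * i + a)"]) (use step in auto)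
    have "finite {i. row_len D (2 * i + a) \<noteq> 0}"
    proof (rule finite_subset)
      show "{i. row_len D (2 * i + a) \<noteq> 0} \<subseteq> {..Max (fst ` D)}"
      proof clarsimp
        fix i assume "0 < row_len D (2 * i + a)"
        then have "(2 * i + a, 1) \<in> D" by (simp add: row)
        then have "2 * i + a \<le> Max (fst ` D)"
          using fin by (intro Max_ge) (auto simp: image_iff intro!: bexI)
        then show "i \<le> Max (fst ` D)" by simp
      qed
    qed simp
    then obtain b where "row_len D (2 * i + a) \<noteq> 0 \<Longrightarrow> i < b" for i
      using finite_nat_set_iff_bounded by auto
    then have ex: "\<exists>b. row_len D (2 * b + a) = 0" by blast
    \<comment> \<open>As the lengths decrease weakly, all rows from the first empty one on are
      empty, so \<open>l\<close> is the number of parts.\<close>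
    define l where "l = (LEAST b. row_len D (2 * b + a) = 0)"
    have l0: "row_len D (2 * l + a) = 0" unfolding l_def by (rule LeastI_ex[OF ex])
    have l: "row_len D (2 * i + a) \<noteq> 0 \<longleftrightarrow> i < l" for i
      using not_less_Least[of i "\<lambda>b. row_len D (2 * b + a) = 0"] anti[of l i] l0
      unfolding l_def[symmetric] by (metis le_zero_eq not_less)
    define \<mu> where "\<mu> = map (\<lambda>i. row_len D (2 * i + a)) [0..<l]"
    have "is_partition \<mu>"
      unfolding is_partition_def \<mu>_def using anti
      by (auto simp: sorted_wrt_iff_nth_less) (use l in blast)
    moreover have "i < length \<mu> \<and> j < \<mu> ! i \<longleftrightarrow> (2 * i + a, j + 1) \<in> D" for i j
      using l[of i] by (auto simp: \<mu>_def row)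
    ultimately show ?thesis by blast
  qed
  obtain \<mu> where \<mu>: "is_partition \<mu>" "\<And>i j. i < length \<mu> \<and> j < \<mu> ! i \<longleftrightarrow> (2 * i + 1, j + 1) \<in> D"
    using partition[of 1] by auto
  obtain \<nu> where \<nu>: "is_partition \<nu>" "\<And>i j. i < length \<nu> \<and> j < \<nu> ! i \<longleftrightarrow> (2 * i + 2, j + 1) \<in> D"
    using partition[of 2] by auto
  have "D = diagram \<mu> \<nu>"
  proof (intro set_eqI iffI)
    fix p assume p: "p \<in> D"
    obtain r c where rc: "p = (r, c)" by (cases p)
    have "1 \<le> r" "1 \<le> c" using D p rc by auto
    then obtain j where "c = j + 1" by (metis le_add_diff_inverse2)
    moreover obtain i where "r = 2 * i + 1 \<or> r = 2 * i + 2"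
    proof -
      have "r = 2 * ((r - 1) div 2) + 1 \<or> r = 2 * ((r - 1) div 2) + 2"
        using \<open>1 \<le> r\<close> by presburger
      then show ?thesis using that by blast
    qed
    ultimately show "p \<in> diagram \<mu> \<nu>"
      using p rc \<mu>(2) \<nu>(2) by (fastforce simp: diagram_def)
  qed (use \<mu>(2) \<nu>(2) in \<open>auto simp: diagram_def\<close>)
  then show ?thesis using \<mu>(1) \<nu>(1) by (auto simp: bipartition_shape_def)
qed

lemma row_len_iff:
  "bipartition_shape D \<Longrightarrow> (r, c) \<in> D \<longleftrightarrow> 1 \<le> c \<and> c \<le> row_len D r"
  by (rule row_len_iff_gen[OF finite_bipartition_shape]) (use bipartition_shapeD(2,3) in blast)+

section \<open>Increasing fillings and the order of boxes\<close>

definition precedes :: "box \<Rightarrow> box \<Rightarrow> bool" where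
  "precedes p q \<longleftrightarrow>
     fst p = fst q \<and> snd p < snd q \<or> snd p = snd q \<and> fst p < fst q \<and> even (fst p) = even (fst q)"

lemma precedes_irrefl [simp]: "\<not> precedes p p"
  by (simp add: precedes_def)

text \<open>Within a row this is the initial segment property; in a column the distance is an even
  number of rows, covered in steps of two. \<open>precedes\<close> also relates boxes with a zero
  coordinate, hence the bounds on \<open>r\<close> and \<open>c\<close>.\<close>

lemma bipartition_shape_down:
  assumes D: "bipartition_shape D" and "q \<in> D" "precedes (r, c) q" "1 \<le> r" "1 \<le> c"
  shows "(r, c) \<in> D"
proof -
  obtain r' c' where q: "q = (r', c')" by (cases q)
  have col: "(r + 2 * i, c) \<in> D \<Longrightarrow> (r, c) \<in> D" for i
  proof (induction i)
    case (Suc i)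
    then show ?case using bipartition_shapeD(4)[OF D, of "r + 2 * Suc i" c] \<open>1 \<le> r\<close> by auto
  qed simp
  consider "r' = r" "c < c'" | i where "c' = c" "r' = r + 2 * i"
  proof -
    have "\<exists>i. r' = r + 2 * i" if "r < r'" "even r = even r'"
      using that by presburger
    then show ?thesis
      using assms(3) that by (auto simp: precedes_def q)
  qed
  then show ?thesis
    using col assms(2,5) unfolding q by cases (auto simp: row_len_iff[OF D])
qed

text \<open>\<open>precedes\<close> merges the row and the column clause, so that later comparisons
  are made only once. Boxes that differ in both row and column are not related by it; in particular
  it is not transitive.\<close>

lemma increasing_iff:
  "increasing T \<longleftrightarrow> (\<forall>p q x y. precedes p q \<and> T p = Some x \<and> T q = Some y \<longrightarrow> x < y)"
  (is "_ \<longleftrightarrow> ?R")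
proof
  assume "increasing T"
  then have row: "\<And>r c c' x y. T (r, c) = Some x \<Longrightarrow> T (r, c') = Some y \<Longrightarrow> c < c' \<Longrightarrow> x < y"
    and col: "\<And>r r' c x y. T (r, c) = Some x \<Longrightarrow> T (r', c) = Some y \<Longrightarrow> r < r' \<Longrightarrow>
      even r = even r' \<Longrightarrow> x < y"
    unfolding increasing_def by blast+
  show ?R
  proof (intro allI impI, elim conjE)
    fix p q x y
    assume "precedes p q" "T p = Some x" "T q = Some y"
    then show "x < y"
      using row[of "fst p" "snd p" x "snd q" y] col[of "fst p" "snd p" x "fst q" y]
      unfolding precedes_def by (cases p; cases q) auto
  qed
next
  assume ?R
  then have "precedes (r, c) (r', c') \<Longrightarrow> T (r, c) = Some x \<Longrightarrow> T (r', c') = Some y \<Longrightarrow> x < y"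
    for r c r' c' x y by blast
  then show "increasing T"
    unfolding increasing_def precedes_def fst_conv snd_conv by blast
qed

lemma increasingD: "increasing T \<Longrightarrow> precedes p q \<Longrightarrow> T p = Some x \<Longrightarrow> T q = Some y \<Longrightarrow> x < y"
  unfolding increasing_iff by blast

text \<open>Only comparisons with \<open>p\<close> involve the new entry. Emptying \<open>p\<close>
  first discards the old entry, so filling an empty box and replacing an entry are treated alike.
  The case \<open>q = p\<close> is harmless because \<open>precedes\<close> is irreflexive.\<close>

lemma increasing_upd_iff:
  "increasing (T(p \<mapsto> s)) \<longleftrightarrow> increasing (T(p := None)) \<and>
     (\<forall>q x. T q = Some x \<longrightarrow> (precedes q p \<longrightarrow> x < s) \<and> (precedes p q \<longrightarrow> s < x))"
  (is "_ \<longleftrightarrow> ?R")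
proof
  assume inc: "increasing (T(p \<mapsto> s))"
  have D: "precedes a b \<Longrightarrow> (T(p \<mapsto> s)) a = Some x \<Longrightarrow> (T(p \<mapsto> s)) b = Some y \<Longrightarrow> x < y" for a b x y
    using inc unfolding increasing_iff by blast
  have "x < y" if "precedes a b" "(T(p := None)) a = Some x" "(T(p := None)) b = Some y" for a b x y
    using D[OF that(1)] that(2,3) by (auto split: if_splits)
  moreover have "x < s" if "T q = Some x" "precedes q p" for q x
    using D[OF that(2)] that precedes_irrefl by (metis fun_upd_apply)
  moreover have "s < x" if "T q = Some x" "precedes p q" for q x
    using D[OF that(2)] that precedes_irrefl by (metis fun_upd_apply)
  ultimately show ?R unfolding increasing_iff by blast
next
  assume R: ?R
  show "increasing (T(p \<mapsto> s))"
    unfolding increasing_iff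
  proof (intro allI impI, elim conjE)
    fix a b x y
    assume ab: "precedes a b" "(T(p \<mapsto> s)) a = Some x" "(T(p \<mapsto> s)) b = Some y"
    have "precedes a b \<Longrightarrow> (T(p := None)) a = Some x \<Longrightarrow> (T(p := None)) b = Some y \<Longrightarrow> x < y"
      using R unfolding increasing_iff by blast
    moreover have "T q = Some z \<Longrightarrow> (precedes q p \<longrightarrow> z < s) \<and> (precedes p q \<longrightarrow> s < z)" for q z
      using R by blast
    ultimately show "x < y"
      using ab by (cases "a = p"; cases "b = p") auto
  qed
qed

lemma increasing_updD:
  assumes "increasing (T(p \<mapsto> s))" "T q = Some x"
  shows "precedes q p \<Longrightarrow> x < s" "precedes p q \<Longrightarrow> s < x"
  using assms unfolding increasing_upd_iff by blast+

lemma increasing_upd_None: "increasing T \<Longrightarrow> increasing (T(p := None))"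
  unfolding increasing_iff by (simp add: fun_upd_def split: if_splits)

section \<open>Intermediate bitableaux and their entries below a given value\<close>

definition bitab :: "bitableau \<Rightarrow> bool" where
  "bitab T \<longleftrightarrow> bipartition_shape (dom T) \<and> increasing T \<and> inj_on T (dom T)"

lemma bitab_eqD: "bitab T \<Longrightarrow> T p = Some x \<Longrightarrow> T q = Some x \<Longrightarrow> p = q"
  by (auto simp: bitab_def intro: inj_onD[of T "dom T" p q])

lemma bitab_upd:
  assumes "bitab T" "s \<notin> ran T" "bipartition_shape (dom (T(p \<mapsto> s)))" "increasing (T(p \<mapsto> s))"
  shows "bitab (T(p \<mapsto> s))"
  using assms unfolding bitab_def inj_on_def ran_def dom_def by auto

text \<open>The row lengths \<open>row_len (below T s) r\<close> are the numbers \<open>L r\<close>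
  of the overview.\<close>

definition below :: "bitableau \<Rightarrow> nat \<Rightarrow> box set" where
  "below T s = {p. \<exists>x. T p = Some x \<and> x < s}"

lemma below_above: "s \<notin> ran T \<Longrightarrow> T q = Some x \<Longrightarrow> q \<notin> below T s \<Longrightarrow> s < x"
  unfolding below_def by (metis (mono_tags, lifting) linorder_neqE_nat mem_Collect_eq ranI)

text \<open>Entries increase away from the wall and downwards, so the neighbours of a box in the
  opposite directions, which exist by the shape of \<open>T\<close>, carry still smaller
  entries.\<close>

lemma bipartition_shape_below:
  assumes "bitab T"
  shows "bipartition_shape (below T s)"
proof (rule bipartition_shapeI)
  have shape: "bipartition_shape (dom T)" and inc: "increasing T"
    using assms by (auto simp: bitab_def)
  show "finite (below T s)"
    using finite_bipartition_shape[OF shape] by (rule finite_subset[rotated]) (auto simp: below_def)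
  have down: "q \<in> below T s" if p: "p \<in> below T s" and q: "q \<in> dom T" "precedes q p" for p q
  proof -
    obtain x y where "T q = Some x" "T p = Some y" "y < s"
      using p q(1) by (auto simp: below_def)
    then show ?thesis
      using increasingD[OF inc q(2)] by (fastforce simp: below_def)
  qed
  fix r c assume rc: "(r, c) \<in> below T s"
  then have "(r, c) \<in> dom T" by (auto simp: below_def)
  note D = bipartition_shapeD[OF shape this]
  show "1 \<le> r \<and> 1 \<le> c \<and> (1 < c \<longrightarrow> (r, c - 1) \<in> below T s) \<and> (2 < r \<longrightarrow> (r - 2, c) \<in> below T s)"
    using D down[OF rc] by (auto simp: precedes_def)
qed

section \<open>Insertable and available positions in terms of row lengths\<close>

lemma insertable_nonempty:
  assumes "bipartition_shape D" "bipartition_shape (insert p D)" "p \<notin> D"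
  shows "if D = {} then p = (1, 1) \<or> p = (2, 1) else \<exists>q\<in>D. adjacent p q"
proof -
  obtain r c where p: "p = (r, c)" by (cases p)
  note D = bipartition_shapeD[OF assms(2), of r c, unfolded p, simplified]
  have "(r, c - 1) \<in> D" if "1 < c" using D that by auto
  moreover have "(r - 2, c) \<in> D" if "2 < r" using D that by auto
  moreover have "adjacent (r, c) (r, c - 1)" if "1 < c"
    using adjacent.symmetric[OF adjacent.same_row[of r "c - 1"]] that by simp
  moreover have "adjacent (r, c) (r - 2, c)" if "2 < r"
    using adjacent.symmetric[OF adjacent.same_column[of "r - 2" c]] that
    by (metis le_add_diff_inverse2 less_imp_le)
  \<comment> \<open>A new box at (1, 1) or (2, 1) has no neighbour towards the wall or above. A
    nonempty shape contains at least one of these two boxes, hence the other one, which is adjacent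
    across the wall.\<close>
  moreover have "\<exists>q\<in>D. adjacent p q" if small: "\<not> 1 < c" "\<not> 2 < r" and "D \<noteq> {}"
  proof -
    obtain r' c' where q: "(r', c') \<in> D" using \<open>D \<noteq> {}\<close> by auto
    note q1 = bipartition_shapeD(1,2)[OF assms(1) q]
    have c: "c = 1" using D(2) small by simp
    have "(if even r' then 2 else 1, c') \<in> D"
    proof (cases "r' \<le> 2")
      case True
      then have "r' = 1 \<or> r' = 2" using q1 by linarith
      then show ?thesis using q by auto
    next
      case False
      then show ?thesis
        by (intro bipartition_shape_down[OF assms(1) q]) (use q1 in \<open>auto simp: precedes_def\<close>)
    qed
    then have "(if even r' then 2 else 1, 1) \<in> D"
      using q1 by (auto simp: row_len_iff[OF assms(1)])
    then have "(1, 1) \<in> D \<or> (2, 1) \<in> D" by (metis)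
    moreover have "r = 1 \<or> r = 2" using D(1) small by linarith
    moreover have "adjacent (1, 1) (2, 1)" using adjacent.across_wall[of 1] by (simp add: numeral_2_eq_2)
    ultimately show ?thesis
      using assms(3) adjacent.symmetric unfolding p c by (metis)
  qed
  ultimately show ?thesis
    using D(1,2) unfolding p by (cases "1 < c"; cases "2 < r") force+
qed

text \<open>In its row \<open>s\<close> must come right after the smaller entries, and the box
  above, if any, must hold a smaller entry as well. Since \<open>below T s\<close> is closed under
  predecessors, that one box accounts for the whole column above; and no successor of the new box
  lies in \<open>below T s\<close>, so all of them hold larger entries.\<close>

lemma insertable_iff:
  assumes T: "bitab T" and s: "s \<notin> ran T"
  shows "(r, c) \<in> insertable T s \<longleftrightarrow>
    1 \<le> r \<and> c = Suc (row_len (below T s) r) \<and>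
    (r \<le> 2 \<or> row_len (below T s) r < row_len (below T s) (r - 2))"
    (is "?L \<longleftrightarrow> ?R")
proof -
  let ?D = "below T s"
  have shape: "bipartition_shape (dom T)" and inc: "increasing T"
    using T by (auto simp: bitab_def)
  have row: "(r, c) \<in> ?D \<longleftrightarrow> 1 \<le> c \<and> c \<le> row_len ?D r" for r c
    by (rule row_len_iff[OF bipartition_shape_below[OF T]])
  have above: "s < x" if "T q = Some x" "q \<notin> ?D" for q x
    using below_above[OF s that] .
  show ?thesis
  proof
    assume ?L
    then have sh: "bipartition_shape (dom (T((r, c) \<mapsto> s)))"
      and i: "increasing (T((r, c) \<mapsto> s))" and n: "(r, c) \<notin> ?D"
      by (auto simp: insertable_def below_def split: option.splits)
    note rc = bipartition_shapeD[OF sh, of r c, simplified]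
    have lower: "q \<in> ?D" if "precedes q (r, c)" "q \<in> dom T" for q
      using increasing_updD(1)[OF i _ that(1)] that(2) by (auto simp: below_def)
    have "c - 1 \<le> row_len ?D r"
      using rc(3) lower[of "(r, c - 1)"] row[of r "c - 1"]
      by (cases "1 < c") (auto simp: precedes_def)
    then have "c = Suc (row_len ?D r)" using n row rc(2) by auto
    moreover have "c \<le> row_len ?D (r - 2)" if "2 < r"
      using rc(4) lower[of "(r - 2, c)"] row[of "r - 2" c] that by (auto simp: precedes_def)
    ultimately show ?R using rc(1) by (cases "r \<le> 2") auto
  next
    assume R: ?R
    then have n: "(r, c) \<notin> ?D" by (simp add: row)
    have lower: "q \<in> ?D" if q: "precedes q (r, c)" "q \<in> dom T" for q
    proof -
      obtain r' c' where rc': "q = (r', c')" by (cases q)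
      have pos: "1 \<le> r'" "1 \<le> c'" using bipartition_shapeD[OF shape] q rc' by auto
      \<comment> \<open>A predecessor in the column is the box directly above or precedes it, and
        the latter case reduces to the former by closure of \<open>?D\<close>.\<close>
      consider "r' = r" "c' < c" | "c' = c" "r' = r - 2" "2 < r" | "c' = c" "precedes q (r - 2, c)" "2 < r"
      proof -
        have "r' = r - 2 \<or> r' < r - 2 \<and> even (r - 2) = even r" "2 < r"
          if "r' < r" "even r' = even r"
          using that pos(1) by presburger+
        then show ?thesis using q(1) that unfolding rc' precedes_def by auto
      qed
      then show ?thesis
      proof cases
        case 3
        have "(r - 2, c) \<in> ?D" using R 3 by (simp add: row)
        then have "(r', c') \<in> ?D"
          by (rule bipartition_shape_down[OF bipartition_shape_below[OF T]]) (use 3 pos rc' in auto)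
        then show ?thesis by (simp add: rc')
      qed (use R pos in \<open>auto simp: rc' row\<close>)
    qed
    have higher: "q \<notin> ?D" if "precedes (r, c) q" for q
      using bipartition_shape_down[OF bipartition_shape_below[OF T] _ that] n R by auto
    have inc': "increasing (T((r, c) \<mapsto> s))"
      unfolding increasing_upd_iff
      using increasing_upd_None[OF inc] lower higher above by (fastforce simp: below_def)
    have sub: "?D \<subseteq> dom T" by (auto simp: below_def)
    have sh: "bipartition_shape (insert (r, c) (dom T))"
    proof (rule bipartition_shapeI)
      show "finite (insert (r, c) (dom T))" using finite_bipartition_shape[OF shape] by simp
      have left: "(r, c - 1) \<in> dom T" if "1 < c" using R that sub row[of r "c - 1"] by auto
      have up: "(r - 2, c) \<in> dom T" if "2 < r" using R that sub row[of "r - 2" c] by auto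
      fix r' c' assume "(r', c') \<in> insert (r, c) (dom T)"
      then show "1 \<le> r' \<and> 1 \<le> c' \<and> (1 < c' \<longrightarrow> (r', c' - 1) \<in> insert (r, c) (dom T)) \<and>
          (2 < r' \<longrightarrow> (r' - 2, c') \<in> insert (r, c) (dom T))"
        using left up R bipartition_shapeD[OF shape, of r' c'] by auto
    qed
    have "if T = Map.empty then (r, c) = (1, 1) \<or> (r, c) = (2, 1) else \<exists>q\<in>dom T. adjacent (r, c) q"
      if "T (r, c) = None"
      using insertable_nonempty[OF shape sh] that by (simp add: domIff)
    then show ?L
      using inc' sh above[OF _ n] by (auto simp: insertable_def split: option.splits)
  qed
qed

text \<open>The replaced entry must be the last smaller one of its row, and the box below must not
  hold a smaller entry. Comparisons with predecessors survive because the entry grows. The strict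
  inequality also gives \<open>L r > 0\<close>, so the box exists.\<close>

lemma available_iff:
  assumes T: "bitab T" and s: "s \<notin> ran T"
  shows "(r, c) \<in> available T s \<longleftrightarrow>
    1 \<le> r \<and> c = row_len (below T s) r \<and> row_len (below T s) (r + 2) < row_len (below T s) r"
    (is "?L \<longleftrightarrow> ?R")
proof -
  let ?D = "below T s"
  have shape: "bipartition_shape (dom T)" and inc: "increasing T"
    using T by (auto simp: bitab_def)
  have D: "bipartition_shape ?D" by (rule bipartition_shape_below[OF T])
  have row: "(r, c) \<in> ?D \<longleftrightarrow> 1 \<le> c \<and> c \<le> row_len ?D r" for r c
    by (rule row_len_iff[OF D])
  have above: "s < x" if "T q = Some x" "q \<notin> ?D" for q x
    using below_above[OF s that] .
  show ?thesis
  proof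
    assume ?L
    then have i: "increasing (T((r, c) \<mapsto> s))" and m: "(r, c) \<in> ?D"
      by (auto simp: available_def below_def)
    have "q \<notin> ?D" if "precedes (r, c) q" for q
      using increasing_updD(2)[OF i _ that] by (auto simp: below_def dest: order.strict_trans)
    then have "(r, Suc c) \<notin> ?D" "(r + 2, c) \<notin> ?D" by (auto simp: precedes_def)
    then show ?R using m bipartition_shapeD(1)[OF D m] by (auto simp: row)
  next
    assume R: ?R
    then have m: "(r, c) \<in> ?D" by (simp add: row)
    then obtain x where x: "T (r, c) = Some x" "x < s" by (auto simp: below_def)
    have "q \<notin> ?D" if "precedes (r, c) q" for q
    proof
      assume q: "q \<in> ?D"
      obtain r' c' where rc': "q = (r', c')" by (cases q)
      consider "r' = r" "c < c'" | "c' = c" "r' = r + 2" | "c' = c" "precedes (r + 2, c) q"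
      proof -
        have "r' = r + 2 \<or> r + 2 < r'" if "r < r'" "even r = even r'"
          using that by presburger
        then show ?thesis using \<open>precedes (r, c) q\<close> that unfolding rc' precedes_def by auto
      qed
      then show False
      proof cases
        case 3
        then show False
          using bipartition_shape_down[OF D q, of "r + 2" c] R by (auto simp: row)
      qed (use R q in \<open>auto simp: rc' row\<close>)
    qed
    then have "increasing (T((r, c) \<mapsto> s))"
      unfolding increasing_upd_iff
      using increasing_upd_None[OF inc] above x inc
      by (meson increasing_iff order.strict_trans)
    then show ?L using x by (auto simp: available_def)
  qed
qed

lemma insertable_row_inj:
  "bitab T \<Longrightarrow> s \<notin> ran T \<Longrightarrow> p \<in> insertable T s \<Longrightarrow> q \<in> insertable T s \<Longrightarrow> fst p = fst q \<Longrightarrow> p = q"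
  by (cases p; cases q) (auto simp: insertable_iff)

lemma available_row_inj:
  "bitab T \<Longrightarrow> s \<notin> ran T \<Longrightarrow> p \<in> available T s \<Longrightarrow> q \<in> available T s \<Longrightarrow> fst p = fst q \<Longrightarrow> p = q"
  by (cases p; cases q) (auto simp: available_iff)

section \<open>Choice by row number and the duality of the two choices\<close>

lemma the_unique_eq_Some_iff: "the_unique P = Some p \<longleftrightarrow> P p \<and> (\<forall>q. P q \<longrightarrow> q = p)"
proof -
  have "(\<exists>!x. P x) \<Longrightarrow> P (THE x. P x)" by (rule theI')
  then show ?thesis
    unfolding the_unique_def by (auto intro: the_equality)
qed

text \<open>With at most one position per row, an extremal row number singles out one position, as
  \<open>the_unique\<close> requires.\<close>

lemma lowest_row_eq_Some_iff:
  "inj_on fst P \<Longrightarrow> lowest_row P = Some p \<longleftrightarrow> p \<in> P \<and> (\<forall>q\<in>P. fst p \<le> fst q)"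
  unfolding lowest_row_def the_unique_eq_Some_iff by (meson inj_onD order_antisym)

lemma highest_row_eq_Some_iff:
  "inj_on fst P \<Longrightarrow> highest_row P = Some p \<longleftrightarrow> p \<in> P \<and> (\<forall>q\<in>P. fst q \<le> fst p)"
  unfolding highest_row_def the_unique_eq_Some_iff by (meson inj_onD order_antisym)

text \<open>Both sides amount to \<open>L r < L (r - 2)\<close>.\<close>

lemma insertable_iff_available_above:
  assumes "bitab T" "s \<notin> ran T" "2 < r"
  shows "(\<exists>c. (r, c) \<in> insertable T s) \<longleftrightarrow> (\<exists>c. (r - 2, c) \<in> available T s)"
proof -
  have "Suc (Suc (r - 2)) = r" using assms(3) by simp
  then show ?thesis
    using assms by (simp add: insertable_iff available_iff)
qed

text \<open>Both sides say that \<open>fst q \<le> fst p + 1\<close> and that a gap is free: no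
  insertable row from \<open>fst q + 1\<close> to \<open>fst p + 1\<close>, respectively no
  available row from \<open>fst q - 1\<close> to \<open>fst p - 1\<close>. The duality shifts one
  gap to the other by two rows. It applies because \<open>1 < fst q\<close> puts all rows of the
  first gap beyond row 2.\<close>

lemma highest_row_iff_lowest_row:
  assumes T: "bitab T" and s: "s \<notin> ran T"
    and q: "q \<in> insertable T s" "1 < fst q" and p: "p \<in> available T s"
  shows "highest_row {q \<in> insertable T s. fst q \<le> fst p + 1} = Some q \<longleftrightarrow>
    lowest_row {p \<in> available T s. fst p \<ge> fst q - 1} = Some p"
proof -
  have I: "inj_on fst {q \<in> insertable T s. fst q \<le> fst p + 1}"
    using insertable_row_inj[OF T s] by (auto intro: inj_onI)
  have A: "inj_on fst {p \<in> available T s. fst p \<ge> fst q - 1}"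
    using available_row_inj[OF T s] by (auto intro: inj_onI)
  have IA: "\<exists>c. (fst q - 2, c) \<in> available T s" if "q \<in> insertable T s" "2 < fst q" for q
    using insertable_iff_available_above[OF T s that(2)] that(1) by (metis prod.collapse)
  have AI: "\<exists>c. (fst p + 2, c) \<in> insertable T s" if "p \<in> available T s" for p
  proof -
    have "2 < fst p + 2" using that available_iff[OF T s, of "fst p" "snd p"] by simp
    from insertable_iff_available_above[OF T s this] show ?thesis
      using that by (cases p) auto
  qed
  show ?thesis
    unfolding highest_row_eq_Some_iff[OF I] lowest_row_eq_Some_iff[OF A]
  proof (intro iffI conjI ballI)
    assume l: "q \<in> {q \<in> insertable T s. fst q \<le> fst p + 1} \<and>
      (\<forall>q'\<in>{q \<in> insertable T s. fst q \<le> fst p + 1}. fst q' \<le> fst q)"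
    then show "p \<in> {p \<in> available T s. fst p \<ge> fst q - 1}" using p by auto
    fix p' assume p': "p' \<in> {p \<in> available T s. fst p \<ge> fst q - 1}"
    then obtain c where "(fst p' + 2, c) \<in> insertable T s" using AI by blast
    then have "fst p' + 2 \<le> fst p + 1 \<Longrightarrow> fst p' + 2 \<le> fst q" using l by fastforce
    then show "fst p \<le> fst p'" using p' q(2) by fastforce
  next
    assume l: "p \<in> {p \<in> available T s. fst p \<ge> fst q - 1} \<and>
      (\<forall>p'\<in>{p \<in> available T s. fst p \<ge> fst q - 1}. fst p \<le> fst p')"
    then show "q \<in> {q \<in> insertable T s. fst q \<le> fst p + 1}" using q by auto
    fix q' assume q': "q' \<in> {q \<in> insertable T s. fst q \<le> fst p + 1}"
    show "fst q' \<le> fst q"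
    proof (rule ccontr)
      assume less: "\<not> fst q' \<le> fst q"
      then obtain c where "(fst q' - 2, c) \<in> available T s" using IA[of q'] q' q(2) by auto
      moreover have "fst q - 1 \<le> fst q' - 2" using less by linarith
      ultimately have "fst p \<le> fst q' - 2" using l by fastforce
      moreover have "fst q' \<le> fst p + 1" using q' by simp
      ultimately show False using less q(2) by linarith
    qed
  qed
qed

section \<open>A single replacement and its reversal\<close>

lemma insertable_replace:
  assumes T: "bitab T" and s: "s \<notin> ran T" and p: "p \<in> insertable T s"
  shows "bitab (T(p \<mapsto> s))"
    and "T p = Some s' \<Longrightarrow> s < s' \<and> s' \<notin> ran (T(p \<mapsto> s)) \<and> p \<in> available (T(p \<mapsto> s)) s'"
proof -
  show T1: "bitab (T(p \<mapsto> s))"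
    using p by (intro bitab_upd[OF T s]) (auto simp: insertable_def)
  assume s': "T p = Some s'"
  then have "s < s'" using p by (simp add: insertable_def)
  moreover have "s' \<notin> ran (T(p \<mapsto> s))"
    using bitab_eqD[OF T s'] \<open>s < s'\<close> by (auto simp: ran_def)
  moreover have "T(p \<mapsto> s') = T" using s' by auto
  ultimately show "s < s' \<and> s' \<notin> ran (T(p \<mapsto> s)) \<and> p \<in> available (T(p \<mapsto> s)) s'"
    using T by (simp add: available_def bitab_def)
qed

text \<open>Here and in \<open>insertable_replace\<close>, putting the displaced entry back restores
  the old filling, so the box just used is a legal position for the opposite operation. That the
  opposite algorithm also chooses it is the content of
  \<open>highest_row_iff_lowest_row\<close>.\<close>

lemma available_replace:
  assumes T: "bitab T" and s: "s \<notin> ran T" and p: "p \<in> available T s"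
  obtains s' where "T p = Some s'" "s' < s" "bitab (T(p \<mapsto> s))" "s' \<notin> ran (T(p \<mapsto> s))"
    "p \<in> insertable (T(p \<mapsto> s)) s'"
proof -
  obtain s' where s': "T p = Some s'" "s' < s" and inc: "increasing (T(p \<mapsto> s))"
    using p by (auto simp: available_def)
  have dom: "insert p (dom T) = dom T" using s' by auto
  have T1: "bitab (T(p \<mapsto> s))"
    using T inc dom by (intro bitab_upd[OF T s]) (auto simp: bitab_def)
  moreover have "s' \<notin> ran (T(p \<mapsto> s))"
  proof
    assume "s' \<in> ran (T(p \<mapsto> s))"
    then obtain q where "(T(p \<mapsto> s)) q = Some s'" by (auto simp: ran_def)
    then show False
      using bitab_eqD[OF T s'(1), of q] s'(2) by (auto split: if_splits)
  qed
  moreover have "T(p \<mapsto> s') = T" using s'(1) by auto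
  then have "p \<in> insertable (T(p \<mapsto> s)) s'"
    using T s' dom by (simp add: insertable_def bitab_def)
  ultimately show ?thesis using that s' by blast
qed

lemma finite_ran_bitab: "bitab T \<Longrightarrow> finite (ran T)"
  by (simp add: bitab_def finite_bipartition_shape finite_ran)

text \<open>This invariance of the entries together with the value in transit carries the range
  along a path of unknown length.\<close>

lemma ran_replace:
  assumes "T p = Some s'"
  shows "insert s' (ran (T(p \<mapsto> s))) = insert s (ran T)"
proof -
  have "x \<in> ran (T(p \<mapsto> s)) \<longleftrightarrow> x = s \<or> (\<exists>q. q \<noteq> p \<and> T q = Some x)"
    and "x \<in> ran T \<longleftrightarrow> x = s' \<or> (\<exists>q. q \<noteq> p \<and> T q = Some x)" for x
    using assms unfolding ran_def by force+
  then show ?thesis by blast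
qed

section \<open>Bumping followed by reverse bumping\<close>

lemma bump_None: "T p = None \<Longrightarrow> bump T s p = Some (T(p \<mapsto> s), p)"
  by (subst bump.simps) simp

lemma bump_Some:
  "T p = Some s' \<Longrightarrow> highest_row {q \<in> insertable (T(p \<mapsto> s)) s'. fst q \<le> fst p + 1} = Some q \<Longrightarrow>
    bump T s p = bump (T(p \<mapsto> s)) s' q"
  by (subst bump.simps) simp

lemma unbump_Some:
  assumes "m \<noteq> 1" "lowest_row {p \<in> available T s. m - 1 \<le> fst p} = Some p"
    "p \<in> available T s" "m - 1 \<le> fst p" "T p = Some s'"
  shows "unbump T m s = unbump (T(p \<mapsto> s)) (fst p) s'"
proof -
  have "{p \<in> available T s. m - 1 \<le> fst p} \<noteq> {}" using assms(3,4) by blast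
  then show ?thesis
    using assms(1,2,5) by (subst unbump.simps) (simp add: Let_def del: Collect_empty_eq)
qed

lemma unbump_stop:
  "m \<noteq> 1 \<Longrightarrow> {p \<in> available T s. m - 1 \<le> fst p} = {} \<Longrightarrow> unbump T m s = Some (- int s, T)"
  by (subst unbump.simps) (simp add: Let_def)

lemma unbump_row_1: "unbump T 1 s = Some (int s, T)"
  by (subst unbump.simps) simp

text \<open>Started at the new box, \<open>unbump\<close> retraces the path up to the moment at
  which \<open>s\<close> comes out of row \<open>fst p\<close>. What happens afterwards is left
  open, so that the claim covers every insertable \<open>p\<close> and the induction can pass to the
  next position of the path. Displaced entries grow, so fewer and fewer entries exceed the value in
  transit.\<close>

lemma unbump_bump:
  assumes "bitab T" "s \<notin> ran T" "p \<in> insertable T s"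
  shows "\<exists>T' q y. bump T s p = Some (T', q) \<and> q \<notin> dom T \<and> dom T' = insert q (dom T) \<and>
    bitab T' \<and> ran T' = insert s (ran T) \<and> T' q = Some y \<and>
    unbump (T'(q := None)) (fst q) y = unbump T (fst p) s"
  using assms
proof (induction "card {x \<in> ran T. s < x}" arbitrary: T s p rule: less_induct)
  case less
  note T = less.prems(1) and s = less.prems(2) and p = less.prems(3)
  let ?T = "T(p \<mapsto> s)"
  note T1 = insertable_replace(1)[OF T s p]
  show ?case
  proof (cases "T p")
    case None
    moreover from None have "?T(p := None) = T" by auto
    ultimately show ?thesis
      using T1 by (auto simp: bump_None)
  next
    case (Some s')
    then have s': "s < s'" "s' \<notin> ran ?T" "p \<in> available ?T s'"
      using insertable_replace(2)[OF T s p] by auto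
    let ?Q = "{q \<in> insertable ?T s'. fst q \<le> fst p + 1}"
    have row1: "1 \<le> fst p"
      using s'(3) available_iff[OF T1 s'(2), of "fst p" "snd p"] by simp
    \<comment> \<open>Row 2 is always insertable and is at most \<open>fst p + 1\<close>. So a
      highest row exists and is at least 2, and the stopping rule of \<open>unbump\<close> for row 1
      does not interrupt the way back.\<close>
    have row2: "(2, Suc (row_len (below ?T s') 2)) \<in> ?Q"
      using row1 by (simp add: insertable_iff[OF T1 s'(2)])
    obtain q where q: "q \<in> ?Q" and max: "\<forall>q'\<in>?Q. fst q' \<le> fst q"
      using ex_has_greatest_nat[of "\<lambda>q. q \<in> ?Q", OF row2, of fst "fst p + 2"] by fastforce
    have "2 \<le> fst q" using max row2 by force
    have inj: "inj_on fst ?Q"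
      using insertable_row_inj[OF T1 s'(2)] by (auto intro: inj_onI)
    have high: "highest_row ?Q = Some q"
      unfolding highest_row_eq_Some_iff[OF inj] using q max by blast
    have low: "lowest_row {p \<in> available ?T s'. fst q - 1 \<le> fst p} = Some p"
      using highest_row_iff_lowest_row[OF T1 s'(2) _ _ s'(3), of q] q high \<open>2 \<le> fst q\<close> by simp
    have "{x \<in> ran ?T. s' < x} \<subset> {x \<in> ran T. s < x}"
      using s'(1) ranI[of T, OF Some] by (auto simp: ran_def split: if_splits)
    then have "card {x \<in> ran ?T. s' < x} < card {x \<in> ran T. s < x}"
      by (rule psubset_card_mono[rotated]) (simp add: finite_ran_bitab[OF T])
    from less.hyps[OF this T1 s'(2), of q] q obtain T' q' y where IH:
      "bump ?T s' q = Some (T', q')" "q' \<notin> dom ?T" "dom T' = insert q' (dom ?T)"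
      "bitab T'" "ran T' = insert s' (ran ?T)" "T' q' = Some y"
      "unbump (T'(q' := None)) (fst q') y = unbump ?T (fst q) s'"
      by blast
    have dom: "dom ?T = dom T" using Some by auto
    have "bump T s p = Some (T', q')"
      using bump_Some[OF Some high] IH(1) by simp
    \<comment> \<open>The reverse step takes \<open>s'\<close> out of row \<open>fst q\<close>, puts
      it back into \<open>p\<close> and releases \<open>s\<close>.\<close>
    moreover have "?T(p \<mapsto> s') = T" using Some by auto
    then have "unbump ?T (fst q) s' = unbump T (fst p) s"
      using unbump_Some[OF _ low s'(3), of s] q \<open>2 \<le> fst q\<close> by (simp add: le_diff_conv)
    ultimately show ?thesis
      using IH(2-) dom ran_replace[of T p s' s, OF Some] by metis
  qed
qed

section \<open>Starting positions, stopping rules, and reverse bumping followed by bumping\<close>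

lemma exists_last_row:
  assumes D: "bipartition_shape D" and r: "0 < row_len D r"
  obtains R where "r \<le> R" "0 < row_len D R" "\<And>r'. R < r' \<Longrightarrow> row_len D r' = 0"
proof -
  have bound: "r' \<le> Max (fst ` D)" if "0 < row_len D r'" for r'
  proof -
    have "(r', 1) \<in> D" using that by (simp add: row_len_iff[OF D])
    then have "r' \<in> fst ` D" by force
    then show ?thesis using finite_bipartition_shape[OF D] by simp
  qed
  obtain R where R: "0 < row_len D R" "\<forall>r'. 0 < row_len D r' \<longrightarrow> r' \<le> R"
    using ex_has_greatest_nat[of "\<lambda>r. 0 < row_len D r", OF r, of id "Suc (Max (fst ` D))"] bound
    by (auto simp: less_Suc_eq_le)
  then show ?thesis using that r by (metis gr0I leD)
qed

lemma first_position_pos: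
  assumes "bitab T" "s \<notin> ran T" "0 < s" "p \<in> insertable T s" "fst p = 1"
  shows "first_position T (int s) = Some p"
  using assms insertable_row_inj[OF assms(1,2)]
  by (auto simp: first_position_def the_unique_eq_Some_iff)

text \<open>The hypotheses describe a state in which reverse bumping stops with a barred value. They
  force \<open>L r = 0\<close> for all \<open>r \<ge> fst p - 1\<close>. Hence \<open>p\<close> is
  in the first column, and an insertable row \<open>r > fst p\<close> is impossible because it needs
  \<open>L (r - 2) > 0\<close>.\<close>

lemma first_position_neg:
  assumes T: "bitab T" and s: "s \<notin> ran T"
    and p: "p \<in> insertable T s" "fst p \<noteq> 1" and none: "{q \<in> available T s. fst p - 1 \<le> fst q} = {}"
  shows "first_position T (- int s) = Some p"
proof -
  let ?D = "below T s" and ?P = "{p \<in> insertable T s. snd p = 1}"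
  have D: "bipartition_shape ?D" by (rule bipartition_shape_below[OF T])
  have row: "1 \<le> fst p" using p(1) by (cases p) (simp add: insertable_iff[OF T s])
  have zero: "row_len ?D r = 0" if "fst p - 1 \<le> r" for r
  proof (rule ccontr)
    assume "row_len ?D r \<noteq> 0"
    then obtain R where R: "r \<le> R" "0 < row_len ?D R" "\<And>r'. R < r' \<Longrightarrow> row_len ?D r' = 0"
      using exists_last_row[OF D, of r] by blast
    \<comment> \<open>Two rows below the last nonempty row \<open>R\<close> of \<open>?D\<close> the
      length is 0, so row \<open>R\<close> is available.\<close>
    then have "(R, row_len ?D R) \<in> available T s"
      using row p(2) that by (simp add: available_iff[OF T s])
    then show False using none R(1) that by force
  qed
  have inj: "inj_on fst ?P"
    using insertable_row_inj[OF T s] by (auto intro: inj_onI)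
  have "snd p = 1"
    using p(1) zero[of "fst p"] by (cases p) (simp add: insertable_iff[OF T s])
  moreover have "fst q \<le> fst p" if "q \<in> ?P" for q
  proof (rule ccontr)
    assume less: "\<not> fst q \<le> fst p"
    then have "0 < row_len ?D (fst q - 2)"
      using that row p(2) by (cases q) (auto simp: insertable_iff[OF T s])
    then show False using zero[of "fst q - 2"] less row p(2) by auto
  qed
  ultimately have "highest_row ?P = Some p"
    unfolding highest_row_eq_Some_iff[OF inj] using p(1) by blast
  then show ?thesis by (simp add: first_position_def)
qed

text \<open>This supplies the end of the way back in \<open>unbump_bump\<close>: at the starting
  position of a letter, reverse bumping halts at once and reads off the letter with its
  sign.\<close>

lemma unbump_first_position:
  assumes T: "bitab T" and x: "nat \<bar>x\<bar> \<notin> ran T" "x \<noteq> 0"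
  obtains p where "first_position T x = Some p" "p \<in> insertable T (nat \<bar>x\<bar>)"
    "unbump T (fst p) (nat \<bar>x\<bar>) = Some (x, T)"
proof (cases "0 < x")
  case True
  define p where "p = (1::nat, Suc (row_len (below T (nat \<bar>x\<bar>)) 1))"
  have "p \<in> insertable T (nat \<bar>x\<bar>)" "fst p = 1"
    by (simp_all add: p_def insertable_iff[OF T x(1)])
  then show ?thesis
    using that[of p] first_position_pos[OF T x(1), of p] True unbump_row_1[of T "nat \<bar>x\<bar>"] by simp
next
  case False
  let ?D = "below T (nat \<bar>x\<bar>)"
  have D: "bipartition_shape ?D" by (rule bipartition_shape_below[OF T])
  obtain R where R: "R = 0 \<or> 0 < row_len ?D R" "\<And>r. R < r \<Longrightarrow> row_len ?D r = 0"
  proof (cases "\<exists>r. 0 < row_len ?D r")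
    case True
    then show ?thesis using exists_last_row[OF D] that by metis
  qed (use that[of 0] in auto)
  \<comment> \<open>If \<open>R\<close> is the last row with an entry smaller than the absolute
    value of \<open>x\<close>, then row \<open>R + 2\<close> is insertable in its first column. The
    default \<open>R = 0\<close>, when there is no such entry, leads to row 2.\<close>
  define p where "p = (R + 2, 1::nat)"
  have "p \<in> insertable T (nat \<bar>x\<bar>)" "fst p \<noteq> 1"
    using R by (auto simp: p_def insertable_iff[OF T x(1)])
  moreover have "{q \<in> available T (nat \<bar>x\<bar>). fst p - 1 \<le> fst q} = {}"
    using R(2) by (auto simp: p_def available_iff[OF T x(1)])
  ultimately show ?thesis
    using that[of p] first_position_neg[OF T x(1), of p] unbump_stop[of "fst p" T "nat \<bar>x\<bar>"] False x(2)
    by simp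
qed

text \<open>Inserting the output \<open>x\<close> into \<open>T'\<close> follows the reverse path
  backwards until \<open>s\<close> is about to enter \<open>p\<close>; from there on the two
  computations coincide. Reverse bumping displaces ever smaller entries, whence the induction
  measure. Positivity keeps \<open>x\<close> nonzero, so its sign tells which stopping rule
  applied.\<close>

lemma bump_unbump:
  assumes "bitab T" "s \<notin> ran T" "p \<in> insertable T s" "0 \<notin> ran T" "0 < s"
  shows "\<exists>x T' p'. unbump T (fst p) s = Some (x, T') \<and> x \<noteq> 0 \<and> bitab T' \<and> dom T' = dom T \<and>
    nat \<bar>x\<bar> \<notin> ran T' \<and> insert (nat \<bar>x\<bar>) (ran T') = insert s (ran T) \<and>
    first_position T' x = Some p' \<and> bump T' (nat \<bar>x\<bar>) p' = bump T s p"
  using assms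
proof (induction "card {x \<in> ran T. x < s}" arbitrary: T s p rule: less_induct)
  case less
  note T = less.prems(1) and s = less.prems(2) and p = less.prems(3)
  let ?P = "{q \<in> available T s. fst p - 1 \<le> fst q}"
  consider "fst p = 1" | "fst p \<noteq> 1" "?P = {}" | "fst p \<noteq> 1" "?P \<noteq> {}" by blast
  then show ?case
  proof cases
    case 1
    then show ?thesis
      using less.prems first_position_pos[OF T s less.prems(5) p] unbump_row_1[of T s]
      by (intro exI[of _ "int s"] exI[of _ T] exI[of _ p]) simp
  next
    case 2
    then show ?thesis
      using less.prems first_position_neg[OF T s p] unbump_stop[OF 2]
      by (intro exI[of _ "- int s"] exI[of _ T] exI[of _ p]) simp
  next
    case 3
    then obtain q where q: "q \<in> ?P" "\<forall>q'\<in>?P. fst q \<le> fst q'"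
      using ex_has_least_nat[of "\<lambda>q. q \<in> ?P" _ fst] by blast
    have inj: "inj_on fst ?P"
      using available_row_inj[OF T s] by (auto intro: inj_onI)
    have low: "lowest_row ?P = Some q"
      unfolding lowest_row_eq_Some_iff[OF inj] using q by blast
    have "q \<in> available T s" using q by simp
    from available_replace[OF T s this] obtain s' where s': "T q = Some s'" "s' < s"
      and T1: "bitab (T(q \<mapsto> s))" "s' \<notin> ran (T(q \<mapsto> s))" "q \<in> insertable (T(q \<mapsto> s)) s'" .
    let ?T = "T(q \<mapsto> s)"
    have row: "1 \<le> fst p" using p by (cases p) (simp add: insertable_iff[OF T s])
    have high: "highest_row {p \<in> insertable T s. fst p \<le> fst q + 1} = Some p"
      using highest_row_iff_lowest_row[OF T s p _ \<open>q \<in> available T s\<close>] low row 3(1) by simp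
    have "0 \<notin> ran ?T" "0 < s'"
      using less.prems(4,5) ranI[of T, OF s'(1)] by (auto simp: ran_def split: if_splits intro: gr0I)
    moreover have "{x \<in> ran ?T. x < s'} \<subset> {x \<in> ran T. x < s}"
      using s'(2) ranI[of T, OF s'(1)] by (auto simp: ran_def split: if_splits)
    then have "card {x \<in> ran ?T. x < s'} < card {x \<in> ran T. x < s}"
      by (rule psubset_card_mono[rotated]) (simp add: finite_ran_bitab[OF T])
    ultimately obtain x T' p' where IH: "unbump ?T (fst q) s' = Some (x, T')" "x \<noteq> 0" "bitab T'"
      "dom T' = dom ?T" "nat \<bar>x\<bar> \<notin> ran T'" "insert (nat \<bar>x\<bar>) (ran T') = insert s' (ran ?T)"
      "first_position T' x = Some p'" "bump T' (nat \<bar>x\<bar>) p' = bump ?T s' q"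
      using less.hyps[OF _ T1] by blast
    have "unbump T (fst p) s = unbump ?T (fst q) s'"
      using unbump_Some[OF 3(1) low] q(1) s'(1) by simp
    \<comment> \<open>Putting \<open>s'\<close> back into \<open>q\<close> restores \<open>T\<close>
      and displaces \<open>s\<close>, for which \<open>high\<close> selects
      \<open>p\<close>.\<close>
    moreover have "?T(q \<mapsto> s') = T" using s' by auto
    then have "bump ?T s' q = bump T s p"
      using bump_Some[of ?T q s s' p] high by simp
    moreover have "dom ?T = dom T" using s' by auto
    ultimately show ?thesis
      using IH ran_replace[of T q s' s, OF s'(1)] by metis
  qed
qed

section \<open>Removing a box and adding a largest entry\<close>

lemma bitab_remove:
  assumes T: "bitab T" and p: "T p = Some s" and shape: "bipartition_shape (dom T - {p})"
  shows "bitab (T(p := None))" "s \<notin> ran (T(p := None))" "p \<in> insertable (T(p := None)) s"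
proof -
  let ?T = "T(p := None)"
  have "inj_on ?T (dom ?T)"
    using T by (auto simp: bitab_def inj_on_def)
  then show "bitab ?T"
    using T shape by (simp add: bitab_def increasing_upd_None)
  show "s \<notin> ran ?T"
  proof
    assume "s \<in> ran ?T"
    then obtain q where "q \<noteq> p" "T q = Some s" by (auto simp: ran_def split: if_splits)
    then show False using bitab_eqD[OF T p] by blast
  qed
  have T_eq: "?T(p \<mapsto> s) = T" using p by auto
  have ins: "insert p (dom T - {p}) = dom T" using p by auto
  have dom_T: "dom ?T = dom T - {p}" by auto
  have "if dom ?T = {} then p = (1, 1) \<or> p = (2, 1) else \<exists>q\<in>dom ?T. adjacent p q"
    unfolding dom_T by (rule insertable_nonempty[OF shape]) (use ins T in \<open>simp_all add: bitab_def\<close>)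
  then have "if ?T = Map.empty then p = (1, 1) \<or> p = (2, 1) else \<exists>q\<in>dom ?T. adjacent p q"
    unfolding dom_eq_empty_conv .
  \<comment> \<open>Refilling \<open>p\<close> with \<open>s\<close> gives back \<open>T\<close>. So
    \<open>T\<close> is what a bump of \<open>s\<close> into the empty box \<open>p\<close>
    produces, which is how \<open>bump_unbump\<close> gets applied.\<close>
  then show "p \<in> insertable ?T s"
    using T unfolding insertable_def mem_Collect_eq T_eq bitab_def fun_upd_same option.case by blast
qed

text \<open>All boxes other than \<open>p\<close> form \<open>below R (Suc k)\<close>, whose shape
  is already known.\<close>

lemma bitab_remove_max:
  assumes R: "bitab R" and ran: "ran R = {1..Suc k}" and p: "R p = Some (Suc k)"
  shows "bipartition_shape (dom R - {p})" "bitab (R(p := None))" "ran (R(p := None)) = {1..k}"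
proof -
  have "dom R - {p} = below R (Suc k)"
  proof (intro set_eqI iffI)
    fix q assume "q \<in> dom R - {p}"
    then obtain x where x: "R q = Some x" "q \<noteq> p" by auto
    then have "x \<in> {1..Suc k}" using ran ranI by metis
    moreover have "x \<noteq> Suc k" using bitab_eqD[OF R p, of q] x by blast
    ultimately show "q \<in> below R (Suc k)" using x by (simp add: below_def)
  qed (use p in \<open>auto simp: below_def\<close>)
  then show shape: "bipartition_shape (dom R - {p})"
    using bipartition_shape_below[OF R] by simp
  show "bitab (R(p := None))" by (rule bitab_remove(1)[OF R p shape])
  have "insert (Suc k) (ran (R(p := None))) = ran ((R(p := None))(p \<mapsto> Suc k))"
    by (rule ran_map_upd[symmetric]) simp
  also have "(R(p := None))(p \<mapsto> Suc k) = R" using p by auto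
  finally have "ran (R(p := None)) = {1..Suc k} - {Suc k}"
    using bitab_remove(2)[OF R p shape] ran by blast
  also have "\<dots> = {1..k}" by auto
  finally show "ran (R(p := None)) = {1..k}" .
qed

text \<open>A largest entry can only conflict with boxes that follow \<open>p\<close>, and such a
  box in \<open>R\<close> would by closure force \<open>p\<close> into \<open>dom R\<close>.\<close>

lemma bitab_add_max:
  assumes R: "bitab R" and k: "\<forall>x\<in>ran R. x < k"
    and p: "p \<notin> dom R" and shape: "bipartition_shape (insert p (dom R))"
  shows "bitab (R(p \<mapsto> k))"
proof (rule bitab_upd[OF R])
  show "k \<notin> ran R" using k by blast
  show "bipartition_shape (dom (R(p \<mapsto> k)))" using shape by simp
  have "\<not> precedes p q" if "q \<in> dom R" for q
    using bipartition_shape_down[of "dom R" q "fst p" "snd p"] that R p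
      bipartition_shapeD(1,2)[OF shape, of "fst p" "snd p"] by (auto simp: bitab_def)
  then show "increasing (R(p \<mapsto> k))"
    unfolding increasing_upd_iff
    using R k increasing_upd_None by (auto simp: bitab_def intro: ranI)
qed

section \<open>The two loops undo each other\<close>

lemma insertion_loop_append:
  "insertion_loop k (u @ v) T R =
    Option.bind (insertion_loop k u T R) (\<lambda>(T, R). insertion_loop (k + length u) v T R)"
proof (induction u arbitrary: k T R)
  case (Cons y u)
  show ?case
  proof (cases "first_position T y")
    case p: (Some p)
    then show ?thesis
    proof (cases "bump T (nat \<bar>y\<bar>) p")
      case (Some r)
      then show ?thesis
        using p Cons.IH by (cases r) (simp del: fun_upd_apply)
    qed simp
  qed simp
qed simp

text \<open>Insertion reads the word from the left while reverse bumping finds its last letter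
  first, so the inductions below need a rule for appending a letter.\<close>

lemma insertion_snoc:
  assumes "insertion w = Some (T, R)" "first_position T x = Some p"
    "bump T (nat \<bar>x\<bar>) p = Some (T', q)"
  shows "insertion (w @ [x]) = Some (T', R(q \<mapsto> Suc (length w)))"
  using assms by (simp add: insertion_def insertion_loop_append)

lemma nat_abs_eq_iff: "nat \<bar>x\<bar> = nat \<bar>y\<bar> \<longleftrightarrow> \<bar>x\<bar> = \<bar>y\<bar>"
  by auto

lemma nat_abs_in_image_iff: "nat \<bar>x\<bar> \<in> (\<lambda>y. nat \<bar>y\<bar>) ` A \<longleftrightarrow> \<bar>x\<bar> \<in> abs ` A"
  by (auto simp: nat_abs_eq_iff image_iff)

text \<open>Induction on the last letter: \<open>unbump_bump\<close> leads back from the new box,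
  and \<open>unbump_first_position\<close> reads off the letter. A prefix of a signed permutation
  need not be one, so the absolute values are only assumed to be distinct and nonzero.\<close>

lemma reverse_loop_insertion:
  assumes "distinct (map abs w)" "0 \<notin> set w"
  shows "\<exists>T R. insertion w = Some (T, R) \<and> bitab T \<and> bitab R \<and> dom T = dom R \<and>
    ran T = (\<lambda>x. nat \<bar>x\<bar>) ` set w \<and> ran R = {1..length w} \<and> reverse_loop (length w) T R = Some w"
  using assms
proof (induction w rule: rev_induct)
  case Nil
  have "diagram [] [] = {}" by (simp add: diagram_def)
  then have "bitab Map.empty"
    by (auto simp: bitab_def bipartition_shape_def increasing_def is_partition_def
        intro!: exI[of _ "[]"])
  then show ?case by (simp add: insertion_def)
next
  case (snoc x w)
  then obtain T R where T: "bitab T" and R: "bitab R" and dom: "dom T = dom R"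
    and ran: "ran T = (\<lambda>x. nat \<bar>x\<bar>) ` set w" "ran R = {1..length w}"
    and w: "insertion w = Some (T, R)" "reverse_loop (length w) T R = Some w"
    by auto
  have x: "nat \<bar>x\<bar> \<notin> ran T" "x \<noteq> 0"
    using snoc.prems by (auto simp: ran(1) nat_abs_in_image_iff)
  obtain p where p: "first_position T x = Some p" "p \<in> insertable T (nat \<bar>x\<bar>)"
    "unbump T (fst p) (nat \<bar>x\<bar>) = Some (x, T)"
    using unbump_first_position[OF T x] .
  obtain T' q y where T': "bump T (nat \<bar>x\<bar>) p = Some (T', q)" "q \<notin> dom T"
    "dom T' = insert q (dom T)" "bitab T'" "ran T' = insert (nat \<bar>x\<bar>) (ran T)" "T' q = Some y"
    "unbump (T'(q := None)) (fst q) y = Some (x, T)"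
    using unbump_bump[OF T x(1) p(2)] unfolding p(3) by blast
  define R' where "R' = R(q \<mapsto> Suc (length w))"
  have "bitab R'" unfolding R'_def
    by (rule bitab_add_max[OF R]) (use T'(2,3,4) dom in \<open>auto simp: ran(2) bitab_def\<close>)
  have "R q = None" using T'(2) dom by auto
  then have ranR: "ran R' = {1..Suc (length w)}"
    using ran(2) by (simp add: R'_def atLeastAtMostSuc_conv)
  have R'_q: "R' q = Some (Suc (length w))" by (simp add: R'_def)
  then have "the_unique (\<lambda>p. R' p = Some (Suc (length w))) = Some q"
    using bitab_eqD[OF \<open>bitab R'\<close>] unfolding the_unique_eq_Some_iff by blast
  moreover have "R'(q := None) = R" using \<open>R q = None\<close> by (auto simp: R'_def)
  ultimately have "reverse_loop (Suc (length w)) T' R' = Some (w @ [x])"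
    using T'(6,7) w(2) by simp
  moreover have "ran T' = (\<lambda>x. nat \<bar>x\<bar>) ` set (w @ [x])" using T'(5) ran(1) by simp
  moreover have "dom R' = dom T'" using T'(3) dom by (simp add: R'_def)
  moreover have "insertion (w @ [x]) = Some (T', R')"
    using insertion_snoc[OF w(1) p(1) T'(1)] by (simp add: R'_def)
  ultimately show ?case
    using T'(4) \<open>bitab R'\<close> ranR by simp
qed

text \<open>Each round removes the largest label from \<open>R\<close>, but from \<open>T\<close>
  the absolute value of the letter found, which can be any entry. So only \<open>R\<close> is
  required to have the entries \<open>{1..k}\<close>.\<close>

lemma insertion_reverse_loop:
  assumes "bitab T" "bitab R" "dom T = dom R" "ran R = {1..k}" "0 \<notin> ran T"
  shows "\<exists>w. reverse_loop k T R = Some w \<and> length w = k \<and> distinct (map abs w) \<and> 0 \<notin> set w \<and>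
    (\<lambda>x. nat \<bar>x\<bar>) ` set w = ran T \<and> insertion w = Some (T, R)"
  using assms
proof (induction k arbitrary: T R)
  case 0
  then have "R p = None" for p
    using ranI[of R p] by (cases "R p") auto
  then have "R = Map.empty" by blast
  moreover from this 0 have "T = Map.empty" by simp
  ultimately show ?case by (simp add: insertion_def)
next
  case (Suc k)
  note T = Suc.prems(1) and R = Suc.prems(2)
  have "Suc k \<in> ran R" using Suc.prems(4) by simp
  then obtain p where p: "R p = Some (Suc k)" by (auto simp: ran_def)
  then have unique: "the_unique (\<lambda>p. R p = Some (Suc k)) = Some p"
    using bitab_eqD[OF R] unfolding the_unique_eq_Some_iff by blast
  note R' = bitab_remove_max[OF R Suc.prems(4) p]
  obtain s where s: "T p = Some s" using p Suc.prems(3) by blast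
  let ?T = "T(p := None)" and ?R = "R(p := None)"
  note T1 = bitab_remove[OF T s, unfolded Suc.prems(3), OF R'(1)]
  have T_eq: "?T(p \<mapsto> s) = T" using s by auto
  have ran: "insert s (ran ?T) = ran T"
    using ran_map_upd[of ?T p s] T_eq by simp
  then have pos: "0 \<notin> ran ?T" "0 < s" using Suc.prems(5) by (auto intro: gr0I)
  \<comment> \<open>As \<open>p\<close> is empty in \<open>?T\<close>, this bump ends at once.
    Through \<open>bump_unbump\<close>, inserting \<open>x\<close> into \<open>T'\<close> therefore
    ends with \<open>T\<close> and the new box \<open>p\<close>, exactly where \<open>R\<close> has
    its label \<open>Suc k\<close>.\<close>
  have b: "bump ?T s p = Some (T, p)" using bump_None[of ?T p s] T_eq by simp
  obtain x T' p' where x: "unbump ?T (fst p) s = Some (x, T')" "x \<noteq> 0" "bitab T'"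
    "dom T' = dom ?T" "nat \<bar>x\<bar> \<notin> ran T'" "insert (nat \<bar>x\<bar>) (ran T') = ran T"
    "first_position T' x = Some p'" "bump T' (nat \<bar>x\<bar>) p' = Some (T, p)"
    using bump_unbump[OF T1 pos] unfolding ran b by blast
  have "dom T' = dom ?R" "0 \<notin> ran T'" using x(4,6) Suc.prems(3,5) by auto
  from Suc.IH[OF x(3) R'(2) this(1) R'(3) this(2)] obtain w where
    w: "reverse_loop k T' ?R = Some w" "length w = k" "distinct (map abs w)" "0 \<notin> set w"
      "(\<lambda>x. nat \<bar>x\<bar>) ` set w = ran T'" "insertion w = Some (T', ?R)"
    by blast
  have "\<bar>x\<bar> \<notin> abs ` set w" using x(5) unfolding w(5)[symmetric] nat_abs_in_image_iff .
  moreover have "reverse_loop (Suc k) T R = Some (w @ [x])"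
    using unique s x(1) w(1) by simp
  moreover have "?R(p \<mapsto> Suc (length w)) = R" using p w(2) by auto
  then have "insertion (w @ [x]) = Some (T, R)"
    using insertion_snoc[OF w(6) x(7,8)] by simp
  ultimately show ?case
    using w(2-5) x(2,6) by (intro exI[of _ "w @ [x]"]) simp
qed

section \<open>Translation to standard bitableaux and signed permutations\<close>

lemma card_diagram: "card (diagram \<mu> \<nu>) = sum_list \<mu> + sum_list \<nu>"
proof -
  let ?M = "SIGMA i:{..<length \<mu>}. {..<\<mu> ! i}" and ?f = "\<lambda>(i, j). (2 * i + 1, j + 1) :: box"
  let ?N = "SIGMA i:{..<length \<nu>}. {..<\<nu> ! i}" and ?g = "\<lambda>(i, j). (2 * i + 2, j + 1) :: box"
  have "2 * i + 1 \<noteq> 2 * j + (2::nat)" for i j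
    by presburger
  then have "?f x \<noteq> ?g y" for x y
    by (simp only: split_beta prod.inject simp_thms)
  then have "card (?f ` ?M \<union> ?g ` ?N) = card (?f ` ?M) + card (?g ` ?N)"
    by (intro card_Un_disjoint) blast+
  also have "card (?f ` ?M) = card ?M" by (rule card_image) (auto simp: inj_on_def)
  also have "card (?g ` ?N) = card ?N" by (rule card_image) (auto simp: inj_on_def)
  finally show ?thesis
    unfolding diagram_eq by (simp add: sum_list_sum_nth atLeast0LessThan)
qed

lemma inj_on_the_iff: "inj_on (the \<circ> T) (dom T) \<longleftrightarrow> inj_on T (dom T)"
  unfolding inj_on_def by (metis comp_apply domIff option.expand)

lemma the_image_dom: "(the \<circ> T) ` dom T = ran T"
  by (force simp: ran_def)

lemma card_dom_bitab:
  assumes "bitab T" "ran T = {1..n}"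
  shows "card (dom T) = n"
proof -
  have "inj_on (the \<circ> T) (dom T)" using assms(1) by (simp add: bitab_def inj_on_the_iff)
  from card_image[OF this] show ?thesis unfolding the_image_dom assms(2) by simp
qed

lemma standard_bitableaux_iff:
  "T \<in> standard_bitableaux \<mu> \<nu> \<longleftrightarrow>
    dom T = diagram \<mu> \<nu> \<and> increasing T \<and> inj_on T (dom T) \<and> ran T = {1..sum_list \<mu> + sum_list \<nu>}"
  unfolding standard_bitableaux_def bij_betw_def mem_Collect_eq
  by (metis inj_on_the_iff the_image_dom)

text \<open>The loop lemmas know a shape only as a set of boxes. Counting boxes, by distinctness of
  the entries and by \<open>card_diagram\<close>, recovers the size of the bipartition.\<close>

lemma bitableau_pairs_iff:
  "(T, R) \<in> bitableau_pairs n \<longleftrightarrow>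
    bitab T \<and> bitab R \<and> dom T = dom R \<and> ran T = {1..n} \<and> ran R = {1..n}"
proof
  assume "(T, R) \<in> bitableau_pairs n"
  then obtain \<mu> \<nu> where "(\<mu>, \<nu>) \<in> bipartitions n"
    "T \<in> standard_bitableaux \<mu> \<nu>" "R \<in> standard_bitableaux \<mu> \<nu>"
    by (auto simp: bitableau_pairs_def)
  then show "bitab T \<and> bitab R \<and> dom T = dom R \<and> ran T = {1..n} \<and> ran R = {1..n}"
    by (auto simp: bipartitions_def standard_bitableaux_iff bitab_def bipartition_shape_def)
next
  assume TR: "bitab T \<and> bitab R \<and> dom T = dom R \<and> ran T = {1..n} \<and> ran R = {1..n}"
  then obtain \<mu> \<nu> where p: "is_partition \<mu>" "is_partition \<nu>" and D: "dom T = diagram \<mu> \<nu>"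
    by (auto simp: bitab_def bipartition_shape_def)
  have "card (dom T) = n" using TR card_dom_bitab by blast
  then have "sum_list \<mu> + sum_list \<nu> = n" unfolding D card_diagram .
  then have "(\<mu>, \<nu>) \<in> bipartitions n"
    and "T \<in> standard_bitableaux \<mu> \<nu>" "R \<in> standard_bitableaux \<mu> \<nu>"
    using p TR D by (auto simp: bipartitions_def standard_bitableaux_iff bitab_def)
  then show "(T, R) \<in> bitableau_pairs n"
    unfolding bitableau_pairs_def by blast
qed

lemma signed_permutations_iff:
  "w \<in> signed_permutations n \<longleftrightarrow>
    length w = n \<and> distinct (map abs w) \<and> 0 \<notin> set w \<and> (\<lambda>x. nat \<bar>x\<bar>) ` set w = {1..n}"
proof -
  have "abs ` set w = {1..int n} \<longleftrightarrow> 0 \<notin> set w \<and> (\<lambda>x. nat \<bar>x\<bar>) ` set w = {1..n}"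
  proof
    assume a: "abs ` set w = {1..int n}"
    have "(\<lambda>x. nat \<bar>x\<bar>) ` set w = nat ` {1..int n}" unfolding a[symmetric] by (simp add: image_image)
    also have "{1..int n} = int ` {1..n}" by (simp add: image_int_atLeastAtMost)
    also have "nat ` int ` {1..n} = {1..n}" by (simp add: image_image)
    finally have "(\<lambda>x. nat \<bar>x\<bar>) ` set w = {1..n}" .
    moreover have "0 \<notin> set w"
    proof
      assume "0 \<in> set w"
      then have "\<bar>0\<bar> \<in> abs ` set w" by (rule imageI)
      then show False unfolding a by simp
    qed
    ultimately show "0 \<notin> set w \<and> (\<lambda>x. nat \<bar>x\<bar>) ` set w = {1..n}" by blast
  next
    assume "0 \<notin> set w \<and> (\<lambda>x. nat \<bar>x\<bar>) ` set w = {1..n}"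
    then have "int ` (\<lambda>x. nat \<bar>x\<bar>) ` set w = int ` {1..n}" by simp
    then show "abs ` set w = {1..int n}" by (simp add: image_image image_int_atLeastAtMost)
  qed
  then show ?thesis by (auto simp: signed_permutations_def)
qed

theorem theorem3p8:
  fixes n :: nat
  assumes "n \<ge> 1"
  shows
    "(\<forall>w\<in>signed_permutations n. \<exists>T R.
        insertion w = Some (T, R) \<and> (T, R) \<in> bitableau_pairs n \<and> eRS T R = Some w) \<and>
     (\<forall>(T, R)\<in>bitableau_pairs n. \<exists>w\<in>signed_permutations n.
        eRS T R = Some w \<and> insertion w = Some (T, R)) \<and>
     bij_betw (\<lambda>w. the (insertion w)) (signed_permutations n) (bitableau_pairs n) \<and>
     bij_betw (\<lambda>(T, R). the (eRS T R)) (bitableau_pairs n) (signed_permutations n)"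
proof -
  have ins: "\<exists>T R. insertion w = Some (T, R) \<and> (T, R) \<in> bitableau_pairs n \<and> eRS T R = Some w"
    if "w \<in> signed_permutations n" for w
    using that reverse_loop_insertion[of w] card_dom_bitab
    unfolding signed_permutations_iff bitableau_pairs_iff eRS_def by metis
  have rev: "\<exists>w\<in>signed_permutations n. eRS T R = Some w \<and> insertion w = Some (T, R)"
    if "(T, R) \<in> bitableau_pairs n" for T R
  proof -
    have TR: "bitab T" "bitab R" "dom T = dom R" "ran T = {1..n}" "ran R = {1..n}"
      using that by (auto simp: bitableau_pairs_iff)
    then show ?thesis
      using insertion_reverse_loop[OF TR(1-3,5)] card_dom_bitab[OF TR(2,5)]
      by (auto simp: signed_permutations_iff eRS_def)
  qed
  \<comment> \<open>By \<open>ins\<close> and \<open>rev\<close>, each map sends its set into the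
    other one and undoes the other map.\<close>
  have "bij_betw (\<lambda>w. the (insertion w)) (signed_permutations n) (bitableau_pairs n)"
    by (rule bij_betw_byWitness[where f' = "\<lambda>(T, R). the (eRS T R)"])
      (use ins rev in \<open>fastforce+\<close>)
  moreover have "bij_betw (\<lambda>(T, R). the (eRS T R)) (bitableau_pairs n) (signed_permutations n)"
    by (rule bij_betw_byWitness[where f' = "\<lambda>w. the (insertion w)"])
      (use ins rev in \<open>fastforce+\<close>)
  ultimately show ?thesis using ins rev by blast
qed

end
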